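(* Given any $c$-approximation, polynomial-time algorithm Match-Alg ($c \leq 1$) for the maximum weighted hypergraph matching problem, we can compute in polynomial time a hypermatching $M_{OUT}$ such that its risk is at most $B$ and its expected weight is a $\frac{c}{2+c}$-approximation to the expected weight of the optimal hypermatching that has risk at most $B$.
   Context: Uncertain weighted hypergraph: $n$ nodes, hyperedge set $E$ with $|E|=m$; the reward $w(e)$ of each hyperedge $e$ is drawn independently from a distribution $f_e$ with finite mean $r_e$ (expected reward) and finite standard deviation $\sigma_e$. For a hypermatching $M$ (set of pairwise disjoint hyperedges), its expected weight is $R(M)=\sum_{e\in M} r_e$ and its risk is $risk(M)=\sum_{e\in M}\sigma_e$. $B$ is a given risk budget. The construction (Algorithm 1): remove all hyperedges with $r_e\le 0$ or $\sigma_e>B$; sort the remaining ones as $e_1,\dots,e_m$ so that $\alpha_{e_1}\ge\dots\ge\alpha_{e_m}$ where $\alpha_e=r_e/\sigma_e$; let $H^{(i)}$ contain $e_1,\dots,e_i$ with weights $r_e$, and let $M^{(i)}$ be the output of Match-Alg on $H^{(i)}$. If $risk(M^{(m)})\le B$, output $M^{(m)}$. Otherwise binary search for an index $\ell^*$ with $risk(M^{(\ell^* )})\le B< risk(M^{(\ell^*+1)})$, and output $M_{OUT}$ equal to whichever of $M^{(\ell^* )}$ and $\{e_{\ell^*+1}\}$ has greater expected reward. *)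

theory Defs
  imports "HOL-Probability.Probability" "HOL-Computational_Algebra.Polynomial"
begin

text \<open>
  Model of computation.  Means and standard deviations are arbitrary reals, so running time is
  measured in a real-number (Blum-Shub-Smale, real RAM) model: a while-language over binary trees
  whose leaves may carry reals.  Every tree operation, every field operation and every comparison
  of two numbers costs one step; there is no rounding operation, and only rational constants may
  occur in a program, so that programs are finite texts.
\<close>

datatype val = Nul | Num real | Cell val val

primrec val_size :: "val \<Rightarrow> nat" where
  "val_size Nul = 1"
| "val_size (Num r) = 1"
| "val_size (Cell a b) = 1 + val_size a + val_size b"

datatype arith_op = Add | Sub | Mul | Div

datatype cmp_op = Less | Equal

datatype expr =
    Var nat
  | Null
  | Lit rat
  | Pairing expr expr
  | Left expr
  | Right expr
  | Arith arith_op expr expr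
  | Compare cmp_op expr expr

fun left :: "val \<Rightarrow> val" where
  "left (Cell a b) = a"
| "left v = Nul"

fun right :: "val \<Rightarrow> val" where
  "right (Cell a b) = b"
| "right v = Nul"

primrec arith_fun :: "arith_op \<Rightarrow> real \<Rightarrow> real \<Rightarrow> real" where
  "arith_fun Add = (+)"
| "arith_fun Sub = (-)"
| "arith_fun Mul = (*)"
| "arith_fun Div = (/)"

primrec cmp_fun :: "cmp_op \<Rightarrow> real \<Rightarrow> real \<Rightarrow> bool" where
  "cmp_fun Less = (<)"
| "cmp_fun Equal = (=)"

fun arith_val :: "arith_op \<Rightarrow> val \<Rightarrow> val \<Rightarrow> val" where
  "arith_val f (Num x) (Num y) = Num (arith_fun f x y)"
| "arith_val f u v = Nul"

text \<open>Tests treat \<^term>\<open>Nul\<close> as false and every other value as true.\<close>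

fun cmp_val :: "cmp_op \<Rightarrow> val \<Rightarrow> val \<Rightarrow> val" where
  "cmp_val f (Num x) (Num y) = (if cmp_fun f x y then Num 1 else Nul)"
| "cmp_val f u v = Nul"

type_synonym store = "nat \<Rightarrow> val"

primrec eval :: "expr \<Rightarrow> store \<Rightarrow> val" where
  "eval (Var x) s = s x"
| "eval Null s = Nul"
| "eval (Lit q) s = Num (of_rat q)"
| "eval (Pairing a b) s = Cell (eval a s) (eval b s)"
| "eval (Left a) s = left (eval a s)"
| "eval (Right a) s = right (eval a s)"
| "eval (Arith f a b) s = arith_val f (eval a s) (eval b s)"
| "eval (Compare f a b) s = cmp_val f (eval a s) (eval b s)"

primrec eval_cost :: "expr \<Rightarrow> nat" where
  "eval_cost (Var x) = 1"
| "eval_cost Null = 1"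
| "eval_cost (Lit q) = 1"
| "eval_cost (Pairing a b) = 1 + eval_cost a + eval_cost b"
| "eval_cost (Left a) = 1 + eval_cost a"
| "eval_cost (Right a) = 1 + eval_cost a"
| "eval_cost (Arith f a b) = 1 + eval_cost a + eval_cost b"
| "eval_cost (Compare f a b) = 1 + eval_cost a + eval_cost b"

text \<open>
  \<open>Call x p a\<close> runs \<open>p\<close> as a non-recursive procedure on the value of \<open>a\<close>, in a store of its own,
  and assigns its result to \<open>x\<close>.  Programs take their input from and leave their output in
  variable \<open>0\<close>.
\<close>

datatype prog =
    Skip
  | Assign nat expr
  | Seq prog prog
  | Cond expr prog prog
  | While expr prog
  | Call nat prog expr

definition init_store :: "val \<Rightarrow> store" where
  "init_store v = (\<lambda>_. Nul)(0 := v)"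

text \<open>\<open>exec p s t s'\<close>: started in store \<open>s\<close>, \<open>p\<close> halts after exactly \<open>t\<close> steps in store \<open>s'\<close>.\<close>

inductive exec :: "prog \<Rightarrow> store \<Rightarrow> nat \<Rightarrow> store \<Rightarrow> bool" where
  exec_Skip: "exec Skip s 1 s"
| exec_Assign: "exec (Assign x a) s (1 + eval_cost a) (s(x := eval a s))"
| exec_Seq: "exec p s t s' \<Longrightarrow> exec q s' t' s'' \<Longrightarrow> exec (Seq p q) s (t + t') s''"
| exec_CondT: "eval b s \<noteq> Nul \<Longrightarrow> exec p s t s' \<Longrightarrow>
    exec (Cond b p q) s (1 + eval_cost b + t) s'"
| exec_CondF: "eval b s = Nul \<Longrightarrow> exec q s t s' \<Longrightarrow>
    exec (Cond b p q) s (1 + eval_cost b + t) s'"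
| exec_WhileF: "eval b s = Nul \<Longrightarrow> exec (While b p) s (1 + eval_cost b) s"
| exec_WhileT: "eval b s \<noteq> Nul \<Longrightarrow> exec p s t s' \<Longrightarrow> exec (While b p) s' t' s'' \<Longrightarrow>
    exec (While b p) s (1 + eval_cost b + t + t') s''"
| exec_Call: "exec p (init_store (eval a s)) t s' \<Longrightarrow>
    exec (Call x p a) s (1 + eval_cost a + t) (s(x := s' 0))"

inductive_cases exec_SkipE: "exec Skip s t s'"
inductive_cases exec_AssignE: "exec (Assign x a) s t s'"
inductive_cases exec_SeqE: "exec (Seq p q) s t s'"
inductive_cases exec_CondE: "exec (Cond b p q) s t s'"
inductive_cases exec_WhileE: "exec (While b p) s t s'"
inductive_cases exec_CallE: "exec (Call x p a) s t s'"

lemma exec_deterministic: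
  "exec p s t s' \<Longrightarrow> exec p s u s'' \<Longrightarrow> t = u \<and> s' = s''"
proof (induction arbitrary: u s'' rule: exec.induct)
  case exec_Skip
  then show ?case by (auto elim: exec_SkipE)
next
  case exec_Assign
  then show ?case by (auto elim: exec_AssignE)
next
  case (exec_Seq p s t s1 q t' s2)
  from exec_Seq.prems show ?case
    by (rule exec_SeqE) (auto dest!: exec_Seq.IH)
next
  case (exec_CondT b s p t s1 q)
  from exec_CondT.prems show ?case
    by (rule exec_CondE) (use exec_CondT.hyps(1) in \<open>auto dest!: exec_CondT.IH\<close>)
next
  case (exec_CondF b s q t s1 p)
  from exec_CondF.prems show ?case
    by (rule exec_CondE) (use exec_CondF.hyps(1) in \<open>auto dest!: exec_CondF.IH\<close>)
next
  case (exec_WhileF b s p)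
  from exec_WhileF.prems show ?case
    by (rule exec_WhileE) (use exec_WhileF.hyps in simp_all)
next
  case (exec_WhileT b s p t s1 t' s2)
  from exec_WhileT.prems show ?case
    by (rule exec_WhileE) (use exec_WhileT.hyps(1) in \<open>auto dest!: exec_WhileT.IH\<close>)
next
  case (exec_Call p a s t s1 x)
  from exec_Call.prems show ?case
    by (rule exec_CallE) (auto dest!: exec_Call.IH)
qed

definition runs :: "prog \<Rightarrow> val \<Rightarrow> nat \<Rightarrow> val \<Rightarrow> bool" where
  "runs p v t out \<longleftrightarrow> (\<exists>s. exec p (init_store v) t s \<and> s 0 = out)"


text \<open>
  The \<open>n\<close> nodes are \<open>0, \<dots>, n - 1\<close>; the hyperedges are listed in an arbitrary order, so that
  the hypergraph can serve as the input of a program.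
\<close>

record hypergraph =
  nodes :: nat
  edges :: "nat set list"

abbreviation edge_set :: "'a hypergraph_scheme \<Rightarrow> nat set set" where
  "edge_set H \<equiv> set (edges H)"

definition hypergraph :: "'a hypergraph_scheme \<Rightarrow> bool" where
  "hypergraph H \<longleftrightarrow> distinct (edges H) \<and> (\<forall>e\<in>edge_set H. e \<noteq> {} \<and> e \<subseteq> {..<nodes H})"

definition hypermatching :: "'a hypergraph_scheme \<Rightarrow> nat set set \<Rightarrow> bool" where
  "hypermatching H M \<longleftrightarrow> M \<subseteq> edge_set H \<and> disjoint M"

record weighted_hypergraph = hypergraph +
  weight :: "nat set \<Rightarrow> real"

definition weighted_hypergraph :: "weighted_hypergraph \<Rightarrow> bool" where
  "weighted_hypergraph H \<longleftrightarrow> hypergraph H \<and> (\<forall>e\<in>edge_set H. 0 \<le> weight H e)"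

definition total_weight :: "weighted_hypergraph \<Rightarrow> nat set set \<Rightarrow> real" where
  "total_weight H M = (\<Sum>e\<in>M. weight H e)"

record uncertain_hypergraph = hypergraph +
  reward_dist :: "nat set \<Rightarrow> real measure"

definition uncertain_hypergraph :: "uncertain_hypergraph \<Rightarrow> bool" where
  "uncertain_hypergraph U \<longleftrightarrow> hypergraph U \<and>
     (\<forall>e\<in>edge_set U. prob_space (reward_dist U e) \<and> sets (reward_dist U e) = sets borel \<and>
        integrable (reward_dist U e) (\<lambda>x. x) \<and> integrable (reward_dist U e) (\<lambda>x. x\<^sup>2))"

text \<open>
  The rewards are the coordinates \<open>\<omega> e\<close> of a point drawn from the product of the distributions:
  independent, the one of \<open>e\<close> having distribution \<open>reward_dist U e\<close>.
\<close>

definition rewards :: "uncertain_hypergraph \<Rightarrow> (nat set \<Rightarrow> real) measure" where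
  "rewards U = PiM (edge_set U) (reward_dist U)"

definition expected_reward :: "uncertain_hypergraph \<Rightarrow> nat set \<Rightarrow> real" where
  "expected_reward U e = (\<integral>\<omega>. \<omega> e \<partial>rewards U)"

definition reward_sd :: "uncertain_hypergraph \<Rightarrow> nat set \<Rightarrow> real" where
  "reward_sd U e = sqrt (\<integral>\<omega>. (\<omega> e - expected_reward U e)\<^sup>2 \<partial>rewards U)"

definition expected_weight :: "uncertain_hypergraph \<Rightarrow> nat set set \<Rightarrow> real" where
  "expected_weight U M = (\<Sum>e\<in>M. expected_reward U e)"

definition risk :: "uncertain_hypergraph \<Rightarrow> nat set set \<Rightarrow> real" where
  "risk U M = (\<Sum>e\<in>M. reward_sd U e)"


definition code_list :: "val list \<Rightarrow> val" where
  "code_list vs = foldr Cell vs Nul"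

definition code_nodes :: "nat list \<Rightarrow> val" where
  "code_nodes vs = code_list (map (\<lambda>v. Num (real v)) vs)"

definition code_edge :: "nat set \<Rightarrow> val" where
  "code_edge e = code_nodes (sorted_list_of_set e)"

definition code_weighted :: "weighted_hypergraph \<Rightarrow> val" where
  "code_weighted H = Cell (code_nodes [0..<nodes H])
     (code_list (map (\<lambda>e. Cell (code_edge e) (Num (weight H e))) (edges H)))"

text \<open>
  The input of the risk-bounded problem consists of the hypergraph, the numbers \<open>r\<^sub>e\<close> and
  \<open>\<sigma>\<^sub>e\<close> of its hyperedges, and the budget.
\<close>

definition code_budgeted :: "uncertain_hypergraph \<times> real \<Rightarrow> val" where
  "code_budgeted = (\<lambda>(U, B). Cell (Num B) (Cell (code_nodes [0..<nodes U])
     (code_list (map (\<lambda>e. Cell (code_edge e)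
        (Cell (Num (expected_reward U e)) (Num (reward_sd U e)))) (edges U)))))"

definition codes_edge_set :: "val \<Rightarrow> nat set set \<Rightarrow> bool" where
  "codes_edge_set v M \<longleftrightarrow> (\<exists>es. distinct es \<and> set es = M \<and> v = code_list (map code_edge es))"

text \<open>
  On every instance in \<open>I\<close>, program \<open>p\<close> halts within a number of steps polynomial in the size
  of the input and outputs a set of hyperedges that is a solution of the instance.
\<close>

definition solves_in_poly_time ::
  "prog \<Rightarrow> 'i set \<Rightarrow> ('i \<Rightarrow> val) \<Rightarrow> ('i \<Rightarrow> nat set set \<Rightarrow> bool) \<Rightarrow> bool" where
  "solves_in_poly_time p I code sol \<longleftrightarrow>
     (\<exists>q :: nat poly. \<forall>i\<in>I. \<exists>t out M. runs p (code i) t out \<and>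
        t \<le> poly q (val_size (code i)) \<and> codes_edge_set out M \<and> sol i M)"

definition approx_matching :: "real \<Rightarrow> weighted_hypergraph \<Rightarrow> nat set set \<Rightarrow> bool" where
  "approx_matching c H M \<longleftrightarrow> hypermatching H M \<and>
     total_weight H M \<ge> c * Max (total_weight H ` {M'. hypermatching H M'})"

definition approx_budgeted_matching ::
  "real \<Rightarrow> uncertain_hypergraph \<times> real \<Rightarrow> nat set set \<Rightarrow> bool" where
  "approx_budgeted_matching c = (\<lambda>(U, B) M. hypermatching U M \<and> risk U M \<le> B \<and>
     expected_weight U M \<ge>
       c * Max (expected_weight U ` {M'. hypermatching U M' \<and> risk U M' \<le> B}))"

end

theory Submission
  imports Defs
begin

text \<open>
  Let \<open>G\<close> be the set of hyperedges with \<open>r e > 0\<close> and \<open>\<sigma> e \<le> B\<close>, ordered by \<open>\<sigma> e / r e\<close>, the inverse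
  of the paper's \<open>\<alpha>\<close>, so that \<open>\<sigma> e = 0\<close> needs no special treatment.  Starting from \<open>H = G\<close>, run the
  matching algorithm on \<open>H\<close>, remove the last hyperedge of \<open>H\<close> and repeat; output the best of the
  matchings within the budget and of the single hyperedges in \<open>G\<close>.  This does at least as well as the
  binary search.

  If the first matching is within the budget, it is a \<open>c\<close>-approximation.  Otherwise some matching \<open>M\<close>
  found in \<open>insert x H\<close> exceeds the budget while the next one, found in \<open>H\<close>, does not.  All hyperedges
  in \<open>M\<close> have at least the reward per risk of \<open>x\<close>, and all those outside \<open>H\<close> have at most that, so
  the optimum outside \<open>H\<close> weighs at most \<open>r(M)\<close>.  Up to \<open>x\<close>, both \<open>M\<close> and the optimum inside \<open>H\<close>
  are matchings in \<open>H\<close>.  With \<open>b\<close> the weight of the output, this gives \<open>c * OPT \<le> b + (b + c * b)\<close>.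

  Every loop of the program is an instance of one fold over a list, whose step is called as a
  procedure; this reduces its verification to that of straight-line code.
\<close>

section \<open>The approximation ratio\<close>

lemma budget_exceeded_bound:
  fixes r \<sigma> :: "'a set \<Rightarrow> real"
  assumes G: "finite G" "\<And>e. e \<in> G \<Longrightarrow> 0 < r e" "\<And>e. e \<in> G \<Longrightarrow> 0 \<le> \<sigma> e"
    and opt: "opt \<subseteq> G" "disjoint opt" "sum \<sigma> opt \<le> B"
    and H: "H \<subseteq> G" "x \<in> G"
    and M: "M \<subseteq> insert x H" "disjoint M" "B < sum \<sigma> M"
    and below: "\<And>h. h \<in> insert x H \<Longrightarrow> \<sigma> h / r h \<le> \<sigma> x / r x"
    and above: "\<And>g. g \<in> G - H \<Longrightarrow> \<sigma> x / r x \<le> \<sigma> g / r g"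
    and approx: "\<And>M'. M' \<subseteq> H \<Longrightarrow> disjoint M' \<Longrightarrow> c * sum r M' \<le> b"
    and x: "r x \<le> b" and c: "0 \<le> c"
  shows "c * sum r opt \<le> (2 + c) * b"
proof -
  have fin: "finite opt" "finite M" "finite H"
    using G opt H M by (auto intro: finite_subset)
  have MG: "M \<subseteq> G"
    using M H by blast
  have rx: "0 < r x" and \<sigma>x: "0 \<le> \<sigma> x"
    using G H by auto
  have "\<sigma> x * sum r (opt - H) = (\<Sum>g\<in>opt - H. \<sigma> x * r g)"
    by (rule sum_distrib_left)
  also have "\<dots> \<le> (\<Sum>g\<in>opt - H. r x * \<sigma> g)"
  proof (rule sum_mono)
    fix g assume "g \<in> opt - H"
    then have "g \<in> G - H" using opt by blast
    then show "\<sigma> x * r g \<le> r x * \<sigma> g"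
      using above[of g] G(2)[of g] rx by (simp add: field_simps)
  qed
  also have "\<dots> = r x * sum \<sigma> (opt - H)"
    by (rule sum_distrib_left[symmetric])
  also have "sum \<sigma> (opt - H) \<le> sum \<sigma> opt"
    by (rule sum_mono2) (use fin G opt in auto)
  then have "r x * sum \<sigma> (opt - H) \<le> r x * B"
    using rx opt by (intro mult_left_mono) auto
  finally have out: "\<sigma> x * sum r (opt - H) \<le> r x * B" .
  have "r x * B < r x * sum \<sigma> M"
    using rx M by simp
  also have "\<dots> = (\<Sum>h\<in>M. r x * \<sigma> h)"
    by (rule sum_distrib_left)
  also have "\<dots> \<le> (\<Sum>h\<in>M. \<sigma> x * r h)"
  proof (rule sum_mono)
    fix h assume "h \<in> M"
    then have "\<sigma> h / r h \<le> \<sigma> x / r x" "0 < r h"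
      using below G(2) MG M(1) by auto
    then show "r x * \<sigma> h \<le> \<sigma> x * r h"
      using rx by (simp add: field_simps)
  qed
  also have "\<dots> = \<sigma> x * sum r M"
    by (rule sum_distrib_left[symmetric])
  finally have M': "r x * B < \<sigma> x * sum r M" .
  have "0 \<le> sum \<sigma> opt"
    by (rule sum_nonneg) (use G opt in auto)
  then have "0 \<le> r x * B"
    using rx opt by simp
  then have "0 < \<sigma> x"
    using M' \<sigma>x by (cases "\<sigma> x = 0") auto
  then have heavy: "sum r (opt - H) \<le> sum r M"
    using out M' by (meson less_le_trans less_imp_le mult_le_cancel_left_pos order.strict_trans1)
  have "sum r M \<le> sum r (insert x (M - {x}))"
    by (rule sum_mono2) (use fin G H MG in \<open>auto intro: less_imp_le\<close>)
  also have "\<dots> = r x + sum r (M - {x})"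
    using fin by (subst sum.insert) auto
  finally have "c * sum r M \<le> c * r x + c * sum r (M - {x})"
    using c by (metis distrib_left mult_left_mono)
  moreover have "c * sum r (M - {x}) \<le> b"
    by (rule approx) (use M in \<open>auto intro: pairwise_subset\<close>)
  moreover have "c * r x \<le> c * b"
    using c x by (rule mult_left_mono[rotated])
  moreover have "c * sum r (opt - H) \<le> c * sum r M"
    using heavy c by (rule mult_left_mono)
  moreover have "c * sum r (opt \<inter> H) \<le> b"
    by (rule approx) (use opt in \<open>auto intro: pairwise_subset\<close>)
  moreover have "sum r opt = sum r (opt \<inter> H) + sum r (opt - H)"
    using fin by (metis sum.Int_Diff)
  ultimately show ?thesis
    by (simp add: distrib_left distrib_right)
qed

text \<open>The situation in which the matching \<open>M\<close> found before the removal of \<open>x\<close> was too risky.\<close>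

definition budget_exceeded ::
  "('a set \<Rightarrow> real) \<Rightarrow> ('a set \<Rightarrow> real) \<Rightarrow> real \<Rightarrow> 'a set set \<Rightarrow> 'a set set \<Rightarrow> bool" where
  "budget_exceeded r \<sigma> B G H \<longleftrightarrow> (\<exists>x M. x \<in> G \<and> M \<subseteq> insert x H \<and> disjoint M \<and> B < sum \<sigma> M \<and>
     (\<forall>h\<in>insert x H. \<sigma> h / r h \<le> \<sigma> x / r x) \<and> (\<forall>g\<in>G - H. \<sigma> x / r x \<le> \<sigma> g / r g))"

definition near_optimal ::
  "real \<Rightarrow> ('a set \<Rightarrow> real) \<Rightarrow> ('a set \<Rightarrow> real) \<Rightarrow> real \<Rightarrow> 'a set set \<Rightarrow> real \<Rightarrow> bool" where
  "near_optimal c r \<sigma> B G b \<longleftrightarrow>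
     (\<forall>M\<subseteq>G. disjoint M \<and> sum \<sigma> M \<le> B \<longrightarrow> c * sum r M \<le> (2 + c) * b)"

lemma near_optimal_step:
  fixes r \<sigma> :: "'a set \<Rightarrow> real"
  assumes c: "0 \<le> c"
    and G: "finite G" "\<And>e. e \<in> G \<Longrightarrow> 0 < r e" "\<And>e. e \<in> G \<Longrightarrow> 0 \<le> \<sigma> e"
    and H: "insert x H \<subseteq> G"
    and prev: "insert x H = G \<or> budget_exceeded r \<sigma> B G (insert x H)"
    and max: "\<And>h. h \<in> insert x H \<Longrightarrow> \<sigma> h / r h \<le> \<sigma> x / r x"
    and M: "M \<subseteq> insert x H" "disjoint M"
    and approx: "\<forall>M'\<subseteq>insert x H. disjoint M' \<longrightarrow> c * sum r M' \<le> sum r M"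
    and b: "\<And>e. e \<in> G \<Longrightarrow> r e \<le> b" "sum \<sigma> M \<le> B \<Longrightarrow> sum r M \<le> b"
  shows "near_optimal c r \<sigma> B G b \<or> budget_exceeded r \<sigma> B G H"
proof (cases "sum \<sigma> M \<le> B")
  case True
  have bound: "c * sum r M' \<le> b" if "M' \<subseteq> insert x H" "disjoint M'" for M'
    by (rule order.trans[OF approx[rule_format] b(2)[OF True]]) (use that in auto)
  have "0 \<le> sum r M"
    by (rule sum_nonneg) (use M H G in \<open>auto intro!: less_imp_le\<close>)
  then have b0: "0 \<le> b"
    using b(2)[OF True] by simp
  from prev have "near_optimal c r \<sigma> B G b"
  proof
    assume "insert x H = G"
    moreover have "b \<le> (2 + c) * b"
      using b0 c mult_right_mono[of 1 "2 + c" b] by simp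
    ultimately have "c * sum r M' \<le> (2 + c) * b" if "M' \<subseteq> G" "disjoint M'" for M'
      using bound[of M'] that by simp
    then show ?thesis
      unfolding near_optimal_def by blast
  next
    assume "budget_exceeded r \<sigma> B G (insert x H)"
    then obtain y N where y: "y \<in> G" "N \<subseteq> insert y (insert x H)" "disjoint N" "B < sum \<sigma> N"
      and N: "\<forall>h\<in>insert y (insert x H). \<sigma> h / r h \<le> \<sigma> y / r y"
        "\<forall>g\<in>G - insert x H. \<sigma> y / r y \<le> \<sigma> g / r g"
      unfolding budget_exceeded_def by blast
    have "c * sum r opt \<le> (2 + c) * b" if "opt \<subseteq> G" "disjoint opt" "sum \<sigma> opt \<le> B" for opt
      by (rule budget_exceeded_bound[OF G that H y N(1)[rule_format] N(2)[rule_format] bound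
            b(1)[OF y(1)] c])
    then show ?thesis
      unfolding near_optimal_def by blast
  qed
  then show ?thesis ..
next
  case False
  have "\<sigma> x / r x \<le> \<sigma> g / r g" if g: "g \<in> G - H" for g
  proof (cases "g = x")
    case False
    then have g': "g \<in> G - insert x H"
      using g by blast
    then obtain y where "\<forall>h\<in>insert y (insert x H). \<sigma> h / r h \<le> \<sigma> y / r y"
      "\<forall>g\<in>G - insert x H. \<sigma> y / r y \<le> \<sigma> g / r g"
      using prev unfolding budget_exceeded_def by blast
    then show ?thesis
      using g' by (meson insertCI order.trans)
  qed simp
  then have "budget_exceeded r \<sigma> B G H"
    unfolding budget_exceeded_def using False M H max by (intro exI[of _ x] exI[of _ M]) auto
  then show ?thesis ..
qed

section \<open>Programs with running time bounds\<close>

definition wp :: "prog \<Rightarrow> (nat \<Rightarrow> store \<Rightarrow> bool) \<Rightarrow> store \<Rightarrow> bool" where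
  "wp p Q s \<longleftrightarrow> (\<exists>t s'. exec p s t s' \<and> Q t s')"

lemma wp_Skip [simp]: "wp Skip Q s \<longleftrightarrow> Q 1 s"
  by (auto simp: wp_def intro: exec_Skip[simplified] elim: exec_SkipE)

lemma wp_Assign [simp]: "wp (Assign x a) Q s \<longleftrightarrow> Q (1 + eval_cost a) (s(x := eval a s))"
  unfolding wp_def by (metis exec_Assign exec_AssignE)

lemma wp_Seq [simp]: "wp (Seq p q) Q s \<longleftrightarrow> wp p (\<lambda>t. wp q (\<lambda>t'. Q (t + t'))) s"
proof
  assume "wp (Seq p q) Q s"
  then obtain t s'' where "exec (Seq p q) s t s''" "Q t s''"
    unfolding wp_def by blast
  then show "wp p (\<lambda>t. wp q (\<lambda>t'. Q (t + t'))) s"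
    unfolding wp_def by (elim exec_SeqE) blast
next
  assume "wp p (\<lambda>t. wp q (\<lambda>t'. Q (t + t'))) s"
  then obtain t s' t' s'' where "exec p s t s'" "exec q s' t' s''" "Q (t + t') s''"
    unfolding wp_def by blast
  then show "wp (Seq p q) Q s"
    unfolding wp_def using exec_Seq by blast
qed

lemma wp_Cond [simp]:
  "wp (Cond b p q) Q s \<longleftrightarrow> wp (if eval b s \<noteq> Nul then p else q) (\<lambda>t. Q (1 + eval_cost b + t)) s"
proof (cases "eval b s = Nul")
  case True
  then show ?thesis
    unfolding wp_def by (auto intro: exec_CondF[simplified] elim!: exec_CondE)
next
  case False
  then show ?thesis
    unfolding wp_def by (auto intro: exec_CondT[simplified] elim!: exec_CondE)
qed

lemma wp_exec: "exec p s t s' \<Longrightarrow> wp p Q s \<longleftrightarrow> Q t s'"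
  unfolding wp_def using exec_deterministic by blast

lemma wp_Call:
  assumes "runs p (eval a s) t w"
  shows "wp (Call x p a) Q s \<longleftrightarrow> Q (1 + eval_cost a + t) (s(x := w))"
proof -
  obtain s' where s': "exec p (init_store (eval a s)) t s'" "s' 0 = w"
    using assms unfolding runs_def by blast
  have "exec (Call x p a) s (1 + eval_cost a + t) (s(x := w))"
    using exec_Call[OF s'(1)] s'(2) by simp
  then show ?thesis
    by (rule wp_exec)
qed

definition runs_within :: "prog \<Rightarrow> val \<Rightarrow> nat \<Rightarrow> val \<Rightarrow> bool" where
  "runs_within p v T w \<longleftrightarrow> (\<exists>t\<le>T. runs p v t w)"

lemma runs_withinI:
  "wp p (\<lambda>t s. t \<le> T \<and> s 0 = w) (init_store v) \<Longrightarrow> runs_within p v T w"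
  by (auto simp: runs_within_def runs_def wp_def)

lemma runs_within_mono: "runs_within p v T w \<Longrightarrow> T \<le> T' \<Longrightarrow> runs_within p v T' w"
  unfolding runs_within_def by (meson le_trans)

lemma code_list_simps [simp]:
  "code_list [] = Nul" "code_list (v # vs) = Cell v (code_list vs)"
  by (simp_all add: code_list_def)

text \<open>
  The step of a fold is itself a program, called on \<open>Cell (Cell acc env) x\<close>, where \<open>x\<close> is the
  current list element and \<open>env\<close> does not change during the fold.
\<close>

abbreviation acc_expr :: expr where "acc_expr \<equiv> Left (Left (Var 0))"
abbreviation env_expr :: expr where "env_expr \<equiv> Right (Left (Var 0))"
abbreviation cur_expr :: expr where "cur_expr \<equiv> Right (Var 0)"

abbreviation fold_input :: "expr \<Rightarrow> expr \<Rightarrow> expr \<Rightarrow> expr" where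
  "fold_input a e l \<equiv> Pairing (Pairing a e) l"

definition fold_loop :: "prog \<Rightarrow> prog" where
  "fold_loop g = While (Var 3)
     (Seq (Call 1 g (fold_input (Var 1) (Var 2) (Left (Var 3)))) (Assign 3 (Right (Var 3))))"

definition fold_prog :: "prog \<Rightarrow> prog" where
  "fold_prog g = Seq (Assign 1 acc_expr) (Seq (Assign 2 env_expr) (Seq (Assign 3 cur_expr)
     (Seq (fold_loop g) (Assign 0 (Var 1)))))"

lemma exec_fold_loop:
  assumes step: "\<And>ys x zs a. xs = ys @ x # zs \<Longrightarrow> I ys a \<Longrightarrow>
      \<exists>a'. runs_within g (Cell (Cell a env) (h x)) T a' \<and> I (ys @ [x]) a'"
  shows "xs = ys @ zs \<Longrightarrow> I ys (s 1) \<Longrightarrow> s 2 = env \<Longrightarrow> s 3 = code_list (map h zs) \<Longrightarrow>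
    \<exists>t s'. exec (fold_loop g) s t s' \<and> t \<le> length zs * (T + 20) + 2 \<and> I xs (s' 1)"
proof (induction zs arbitrary: ys s)
  case Nil
  have "exec (fold_loop g) s (1 + eval_cost (Var 3)) s"
    unfolding fold_loop_def by (rule exec_WhileF) (simp add: Nil)
  then show ?case
    using Nil by fastforce
next
  case (Cons x zs)
  obtain a' t where t: "t \<le> T" and run: "runs g (Cell (Cell (s 1) env) (h x)) t a'"
    and a': "I (ys @ [x]) a'"
    using step[OF Cons.prems(1,2)] unfolding runs_within_def by blast
  define body where
    "body = Seq (Call 1 g (fold_input (Var 1) (Var 2) (Left (Var 3)))) (Assign 3 (Right (Var 3)))"
  define s1 where "s1 = s(1 := a', 3 := code_list (map h zs))"
  have "wp body (\<lambda>u s'. u = t + 10 \<and> s' = s1) s"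
    unfolding body_def using run Cons.prems by (simp add: wp_Call s1_def)
  then have body: "exec body s (t + 10) s1"
    unfolding wp_def by blast
  have "\<exists>u s'. exec (fold_loop g) s1 u s' \<and> u \<le> length zs * (T + 20) + 2 \<and> I xs (s' 1)"
    by (rule Cons.IH[of "ys @ [x]"]) (use Cons.prems a' in \<open>auto simp: s1_def\<close>)
  then obtain u s' where u: "exec (fold_loop g) s1 u s'" "u \<le> length zs * (T + 20) + 2"
    "I xs (s' 1)"
    by blast
  have "exec (fold_loop g) s (1 + eval_cost (Var 3) + (t + 10) + u) s'"
    using exec_WhileT[OF _ body u(1)[unfolded fold_loop_def, folded body_def]] Cons.prems
    unfolding fold_loop_def body_def[symmetric] by simp
  then show ?case
    using u t by (intro exI[of _ "1 + eval_cost (Var 3) + (t + 10) + u"] exI[of _ s']) auto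
qed

lemma runs_fold_prog:
  assumes init: "I [] a"
    and len: "length xs \<le> n"
    and step: "\<And>ys x zs a. xs = ys @ x # zs \<Longrightarrow> I ys a \<Longrightarrow>
      \<exists>a'. runs_within g (Cell (Cell a env) (h x)) T a' \<and> I (ys @ [x]) a'"
  shows "\<exists>w. runs_within (fold_prog g) (Cell (Cell a env) (code_list (map h xs))) ((n + 1) * (T + 20)) w
    \<and> I xs w"
proof -
  let ?s = "(init_store (Cell (Cell a env) (code_list (map h xs))))(1 := a, 2 := env, 3 := code_list (map h xs))"
  have "\<exists>t s'. exec (fold_loop g) ?s t s' \<and> t \<le> length xs * (T + 20) + 2 \<and> I xs (s' 1)"
    by (rule exec_fold_loop[where ys = "[]" and h = h and env = env and I = I])
      (use init step in auto)
  then obtain t s' where t: "exec (fold_loop g) ?s t s'" "t \<le> length xs * (T + 20) + 2"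
    "I xs (s' 1)"
    by blast
  have t': "t \<le> n * (T + 20) + 2"
    using t(2) mult_le_mono1[OF len, of "T + 20"] by linarith
  have "wp (fold_prog g) (\<lambda>t s. t \<le> (n + 1) * (T + 20) \<and> s 0 = s' 1)
      (init_store (Cell (Cell a env) (code_list (map h xs))))"
    unfolding fold_prog_def using t'
    by (simp add: init_store_def wp_exec[OF t(1)[unfolded init_store_def, simplified]])
  then have "runs_within (fold_prog g) (Cell (Cell a env) (code_list (map h xs))) ((n + 1) * (T + 20)) (s' 1)"
    by (rule runs_withinI)
  then show ?thesis
    using t(3) by blast
qed

section \<open>The programs\<close>

text \<open>
  The accumulator is the part of the first list still to be matched, and \<open>Num 0\<close>, which no further
  step can turn into \<open>Nul\<close>, records a mismatch.
\<close>

definition eq_step :: prog where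
  "eq_step = Cond (Compare Equal (Left acc_expr) cur_expr)
     (Assign 0 (Right acc_expr)) (Assign 0 (Lit 0))"

definition eq_acc :: "val \<Rightarrow> val \<Rightarrow> val" where
  "eq_acc a x = (if cmp_val Equal (left a) x \<noteq> Nul then right a else Num 0)"

lemma runs_eq_step: "runs_within eq_step (Cell (Cell a env) x) 20 (eq_acc a x)"
  by (intro runs_withinI) (simp add: eq_step_def eq_acc_def init_store_def)

lemma eq_acc_simps:
  "eq_acc (Num y) v = Num 0"
  "eq_acc Nul v = Num 0"
  "eq_acc (Cell (Num y) a) (Num x) = (if x = y then a else Num 0)"
  by (auto simp: eq_acc_def)

lemma foldl_eq_acc:
  "foldl (\<lambda>a v. eq_acc a (Num (real v))) (code_nodes ys) xs = Nul \<longleftrightarrow> xs = ys"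
proof (induction xs arbitrary: ys)
  case Nil
  then show ?case by (cases ys) (auto simp: code_nodes_def)
next
  case (Cons x xs)
  have mismatch: "foldl (\<lambda>a v. eq_acc a (Num (real v))) (Num 0) vs = Num 0" for vs
    by (induction vs) (auto simp: eq_acc_simps)
  show ?case
  proof (cases ys)
    case Nil
    then show ?thesis using mismatch by (simp add: code_nodes_def eq_acc_simps)
  next
    case (Cons y zs)
    then show ?thesis
      using mismatch Cons.IH[of zs] by (simp add: code_nodes_def eq_acc_simps)
  qed
qed

lemma runs_eq:
  assumes "finite e" "finite f" "card f \<le> n"
  shows "\<exists>w. runs_within (fold_prog eq_step) (Cell (Cell (code_edge e) Nul) (code_edge f))
      ((n + 1) * 40) w \<and> (w = Nul \<longleftrightarrow> e = f)"
proof -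
  let ?f = "\<lambda>a v. eq_acc a (Num (real v))" and ?xs = "sorted_list_of_set f"
  have "\<exists>w. runs_within (fold_prog eq_step) (Cell (Cell (code_edge e) Nul)
      (code_list (map (\<lambda>v. Num (real v)) ?xs))) ((n + 1) * (20 + 20)) w \<and>
      w = foldl ?f (code_edge e) ?xs"
    by (rule runs_fold_prog) (use assms runs_eq_step in auto)
  moreover have "sorted_list_of_set f = sorted_list_of_set e \<longleftrightarrow> e = f"
    using assms sorted_list_of_set_inject by blast
  ultimately show ?thesis
    using foldl_eq_acc[of "sorted_list_of_set e" ?xs]
    by (auto simp: code_edge_def code_nodes_def)
qed

definition code_item :: "(nat set \<Rightarrow> real) \<Rightarrow> (nat set \<Rightarrow> real) \<Rightarrow> nat set \<Rightarrow> val" where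
  "code_item r \<sigma> e = Cell (code_edge e) (Cell (Num (r e)) (Num (\<sigma> e)))"

abbreviation code_items :: "(nat set \<Rightarrow> real) \<Rightarrow> (nat set \<Rightarrow> real) \<Rightarrow> nat set list \<Rightarrow> val" where
  "code_items r \<sigma> es \<equiv> code_list (map (code_item r \<sigma>) es)"

abbreviation code_matching :: "nat set list \<Rightarrow> val" where
  "code_matching es \<equiv> code_list (map code_edge es)"

definition add_step :: prog where
  "add_step = Seq (Call 1 (fold_prog eq_step) (fold_input (Left cur_expr) Null env_expr))
     (Cond (Var 1) (Assign 0 acc_expr)
       (Assign 0 (Pairing (Arith Add (Left acc_expr) (Left (Right cur_expr)))
          (Arith Add (Right acc_expr) (Right (Right cur_expr))))))"

lemma runs_add_step:
  assumes "finite e" "finite f" "card f \<le> n"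
  shows "runs_within add_step (Cell (Cell (Cell (Num R) (Num S)) (code_edge f)) (code_item r \<sigma> e))
    ((n + 1) * 40 + 60) (if e = f then Cell (Num (R + r e)) (Num (S + \<sigma> e))
       else Cell (Num R) (Num S))"
proof -
  obtain w t where "runs (fold_prog eq_step) (Cell (Cell (code_edge e) Nul) (code_edge f)) t w"
    "t \<le> (n + 1) * 40" "w = Nul \<longleftrightarrow> e = f"
    using runs_eq[OF assms] unfolding runs_within_def by blast
  then show ?thesis
    by (intro runs_withinI) (simp add: add_step_def init_store_def code_item_def wp_Call)
qed

definition total_step :: prog where
  "total_step = Call 0 (fold_prog add_step) (fold_input acc_expr cur_expr env_expr)"

lemma runs_total_step:
  assumes fin: "\<And>e. e \<in> set hs \<Longrightarrow> finite e \<and> card e \<le> n"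
    and hs: "distinct hs" "length hs \<le> n" "f \<in> set hs"
  shows "runs_within total_step (Cell (Cell (Cell (Num R) (Num S)) (code_items r \<sigma> hs)) (code_edge f))
    ((n + 1) * ((n + 1) * 40 + 80) + 20) (Cell (Num (R + r f)) (Num (S + \<sigma> f)))"
proof -
  let ?I = "\<lambda>es a. a = (if f \<in> set es then Cell (Num (R + r f)) (Num (S + \<sigma> f))
    else Cell (Num R) (Num S))"
  have "\<exists>w. runs_within (fold_prog add_step)
      (Cell (Cell (Cell (Num R) (Num S)) (code_edge f)) (code_items r \<sigma> hs))
      ((n + 1) * (((n + 1) * 40 + 60) + 20)) w \<and> ?I hs w"
  proof (rule runs_fold_prog)
    fix ys e zs a
    assume split: "hs = ys @ e # zs" and a: "?I ys a"
    have f: "f \<notin> set ys" if "e = f"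
      using split hs(1) that by auto
    have e: "finite e" "finite f" "card f \<le> n"
      using fin[of e] fin[of f] hs(3) split by auto
    show "\<exists>a'. runs_within add_step (Cell (Cell a (code_edge f)) (code_item r \<sigma> e))
        ((n + 1) * 40 + 60) a' \<and> ?I (ys @ [e]) a'"
    proof (cases "f \<in> set ys")
      case True
      then have "e \<noteq> f"
        using f by blast
      then show ?thesis
        using True a runs_add_step[OF e, of "R + r f" "S + \<sigma> f" r \<sigma>] by auto
    next
      case False
      then show ?thesis
        using a runs_add_step[OF e, of R S r \<sigma>] by (cases "e = f") auto
    qed
  qed (use hs in auto)
  then obtain t where "t \<le> (n + 1) * ((n + 1) * 40 + 80)"
    "runs (fold_prog add_step) (Cell (Cell (Cell (Num R) (Num S)) (code_edge f)) (code_items r \<sigma> hs))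
      t (Cell (Num (R + r f)) (Num (S + \<sigma> f)))"
    using hs unfolding runs_within_def by (auto simp: add.assoc)
  then show ?thesis
    by (intro runs_withinI) (simp add: total_step_def init_store_def wp_Call)
qed

lemma runs_total:
  assumes fin: "\<And>e. e \<in> set hs \<Longrightarrow> finite e \<and> card e \<le> n"
    and hs: "distinct hs" "length hs \<le> n" "distinct es" "set es \<subseteq> set hs"
  shows "runs_within (fold_prog total_step)
    (Cell (Cell (Cell (Num 0) (Num 0)) (code_items r \<sigma> hs)) (code_matching es))
    ((n + 1) * ((n + 1) * ((n + 1) * 40 + 80) + 40))
    (Cell (Num (sum r (set es))) (Num (sum \<sigma> (set es))))"
proof -
  let ?I = "\<lambda>es a. a = Cell (Num (sum r (set es))) (Num (sum \<sigma> (set es)))"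
  have "\<exists>w. runs_within (fold_prog total_step)
      (Cell (Cell (Cell (Num 0) (Num 0)) (code_items r \<sigma> hs)) (code_matching es))
      ((n + 1) * (((n + 1) * ((n + 1) * 40 + 80) + 20) + 20)) w \<and> ?I es w"
  proof (rule runs_fold_prog)
    show "length es \<le> n"
      using hs card_mono[of "set hs" "set es"] by (simp add: distinct_card)
    fix ys e zs a
    assume split: "es = ys @ e # zs" and a: "?I ys a"
    have e: "e \<notin> set ys" "e \<in> set hs"
      using split hs by auto
    show "\<exists>a'. runs_within total_step (Cell (Cell a (code_items r \<sigma> hs)) (code_edge e))
        ((n + 1) * ((n + 1) * 40 + 80) + 20) a' \<and> ?I (ys @ [e]) a'"
      using runs_total_step[OF fin hs(1,2) e(2), of "sum r (set ys)" "sum \<sigma> (set ys)" r \<sigma>] a e(1)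
      by (intro exI conjI) (auto simp: add.commute)
  qed auto
  then show ?thesis
    by (auto simp: add.assoc)
qed

definition weigh_step :: prog where
  "weigh_step = Assign 0 (Pairing (Pairing (Left cur_expr) (Left (Right cur_expr))) acc_expr)"

lemma runs_weigh:
  assumes "length hs \<le> n"
  shows "runs_within (fold_prog weigh_step) (Cell (Cell Nul Nul) (code_items r \<sigma> hs)) ((n + 1) * 40)
    (code_list (map (\<lambda>e. Cell (code_edge e) (Num (r e))) (rev hs)))"
proof -
  let ?I = "\<lambda>es a. a = code_list (map (\<lambda>e. Cell (code_edge e) (Num (r e))) (rev es))"
  have "runs_within weigh_step (Cell (Cell a Nul) (code_item r \<sigma> e)) 20
      (Cell (Cell (code_edge e) (Num (r e))) a)" for a e
    by (intro runs_withinI) (simp add: weigh_step_def init_store_def code_item_def)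
  then have "\<exists>w. runs_within (fold_prog weigh_step) (Cell (Cell Nul Nul) (code_items r \<sigma> hs))
      ((n + 1) * (20 + 20)) w \<and> ?I hs w"
    by (intro runs_fold_prog) (use assms in auto)
  then show ?thesis
    by auto
qed

definition filter_step :: prog where
  "filter_step = Cond (Compare Less (Lit 0) (Left (Right cur_expr)))
     (Cond (Compare Less env_expr (Right (Right cur_expr))) (Assign 0 acc_expr)
       (Assign 0 (Pairing cur_expr acc_expr)))
     (Assign 0 acc_expr)"

lemma runs_filter:
  assumes "length hs \<le> n"
  shows "runs_within (fold_prog filter_step) (Cell (Cell Nul (Num B)) (code_items r \<sigma> hs))
    ((n + 1) * 60) (code_items r \<sigma> (rev (filter (\<lambda>e. 0 < r e \<and> \<sigma> e \<le> B) hs)))"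
proof -
  let ?P = "\<lambda>e. 0 < r e \<and> \<sigma> e \<le> B"
  let ?I = "\<lambda>es a. a = code_items r \<sigma> (rev (filter ?P es))"
  have "runs_within filter_step (Cell (Cell a (Num B)) (code_item r \<sigma> e)) 40
      (if ?P e then Cell (code_item r \<sigma> e) a else a)" for a e
    by (intro runs_withinI) (simp add: filter_step_def init_store_def code_item_def)
  note step = this
  have "\<exists>w. runs_within (fold_prog filter_step) (Cell (Cell Nul (Num B)) (code_items r \<sigma> hs))
      ((n + 1) * (40 + 20)) w \<and> ?I hs w"
  proof (rule runs_fold_prog)
    fix ys e zs a
    assume "?I ys a"
    then show "\<exists>a'. runs_within filter_step (Cell (Cell a (Num B)) (code_item r \<sigma> e)) 40 a' \<and>
        ?I (ys @ [e]) a'"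
      by (intro exI[of _ "if ?P e then Cell (code_item r \<sigma> e) a else a"] conjI step) simp
  qed (use assms in auto)
  then show ?thesis
    by auto
qed

definition single_step :: prog where
  "single_step = Cond (Compare Less (Right acc_expr) (Left (Right cur_expr)))
     (Assign 0 (Pairing (Pairing (Left cur_expr) Null) (Left (Right cur_expr))))
     (Assign 0 acc_expr)"

lemma runs_single:
  assumes "length hs \<le> n"
  shows "\<exists>es. runs_within (fold_prog single_step)
      (Cell (Cell (Cell Nul (Num 0)) Nul) (code_items r \<sigma> hs)) ((n + 1) * 60)
      (Cell (code_matching es) (Num (sum r (set es)))) \<and>
    (es = [] \<or> (\<exists>e\<in>set hs. es = [e])) \<and> 0 \<le> sum r (set es) \<and> (\<forall>e\<in>set hs. r e \<le> sum r (set es))"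
proof -
  let ?I = "\<lambda>ys a. \<exists>es. a = Cell (code_matching es) (Num (sum r (set es))) \<and>
    (es = [] \<or> (\<exists>e\<in>set ys. es = [e])) \<and> 0 \<le> sum r (set es) \<and> (\<forall>e\<in>set ys. r e \<le> sum r (set es))"
  have "\<exists>w. runs_within (fold_prog single_step)
      (Cell (Cell (Cell Nul (Num 0)) Nul) (code_items r \<sigma> hs)) ((n + 1) * (40 + 20)) w \<and> ?I hs w"
  proof (rule runs_fold_prog)
    show "?I [] (Cell Nul (Num 0))"
      by (rule exI[of _ "[]"]) simp
    fix ys e zs a
    assume "?I ys a"
    then obtain es where es: "a = Cell (code_matching es) (Num (sum r (set es)))"
      "es = [] \<or> (\<exists>e\<in>set ys. es = [e])" "0 \<le> sum r (set es)" "\<forall>e\<in>set ys. r e \<le> sum r (set es)"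
      by blast
    define es' where "es' = (if sum r (set es) < r e then [e] else es)"
    have "runs_within single_step (Cell (Cell a Nul) (code_item r \<sigma> e)) 40
        (Cell (code_matching es') (Num (sum r (set es'))))"
      by (intro runs_withinI)
        (simp add: single_step_def init_store_def code_item_def es(1) es'_def)
    moreover have "?I (ys @ [e]) (Cell (code_matching es') (Num (sum r (set es'))))"
      using es by (intro exI[of _ es']) (auto simp: es'_def)
    ultimately show "\<exists>a'. runs_within single_step (Cell (Cell a Nul) (code_item r \<sigma> e)) 40 a' \<and>
        ?I (ys @ [e]) a'"
      by blast
  qed (use assms in auto)
  then show ?thesis
    by auto
qed

text \<open>The accumulator holds an edge of maximal ratio \<open>\<sigma> e / r e\<close> and the list of the others.\<close>

definition extract_step :: prog where
  "extract_step = Cond (Left acc_expr)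
     (Cond (Compare Less
         (Arith Div (Right (Right (Left acc_expr))) (Left (Right (Left acc_expr))))
         (Arith Div (Right (Right cur_expr)) (Left (Right cur_expr))))
       (Assign 0 (Pairing cur_expr (Pairing (Left acc_expr) (Right acc_expr))))
       (Assign 0 (Pairing (Left acc_expr) (Pairing cur_expr (Right acc_expr)))))
     (Assign 0 (Pairing cur_expr Null))"

lemma runs_extract:
  assumes "length hs \<le> n" "hs \<noteq> []"
  shows "\<exists>x gs. runs_within (fold_prog extract_step)
      (Cell (Cell (Cell Nul Nul) Nul) (code_items r \<sigma> hs)) ((n + 1) * 120)
      (Cell (code_item r \<sigma> x) (code_items r \<sigma> gs)) \<and>
    mset hs = add_mset x (mset gs) \<and> (\<forall>e\<in>set hs. \<sigma> e / r e \<le> \<sigma> x / r x)"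
proof -
  let ?I = "\<lambda>ys a. if ys = [] then a = Cell Nul Nul else
    \<exists>x gs. a = Cell (code_item r \<sigma> x) (code_items r \<sigma> gs) \<and>
      mset ys = add_mset x (mset gs) \<and> (\<forall>e\<in>set ys. \<sigma> e / r e \<le> \<sigma> x / r x)"
  have "\<exists>w. runs_within (fold_prog extract_step)
      (Cell (Cell (Cell Nul Nul) Nul) (code_items r \<sigma> hs)) ((n + 1) * (100 + 20)) w \<and> ?I hs w"
  proof (rule runs_fold_prog)
    fix ys e zs a
    assume I: "?I ys a"
    show "\<exists>a'. runs_within extract_step (Cell (Cell a Nul) (code_item r \<sigma> e)) 100 a' \<and>
        ?I (ys @ [e]) a'"
    proof (cases "ys = []")
      case True
      then have "runs_within extract_step (Cell (Cell a Nul) (code_item r \<sigma> e)) 100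
          (Cell (code_item r \<sigma> e) (code_items r \<sigma> []))"
        using I by (intro runs_withinI) (simp add: extract_step_def init_store_def)
      moreover have "?I (ys @ [e]) (Cell (code_item r \<sigma> e) (code_items r \<sigma> []))"
        using True by (auto intro!: exI[of _ e] exI[of _ "[]"])
      ultimately show ?thesis by blast
    next
      case False
      then obtain x gs where x: "a = Cell (code_item r \<sigma> x) (code_items r \<sigma> gs)"
        "mset ys = add_mset x (mset gs)" "\<forall>e\<in>set ys. \<sigma> e / r e \<le> \<sigma> x / r x"
        using I by auto
      define x' where "x' = (if \<sigma> x / r x < \<sigma> e / r e then e else x)"
      define gs' where "gs' = (if \<sigma> x / r x < \<sigma> e / r e then x else e) # gs"
      have "runs_within extract_step (Cell (Cell a Nul) (code_item r \<sigma> e)) 100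
          (Cell (code_item r \<sigma> x') (code_items r \<sigma> gs'))"
        by (intro runs_withinI)
          (simp add: extract_step_def init_store_def x(1) x'_def gs'_def code_item_def)
      moreover have "?I (ys @ [e]) (Cell (code_item r \<sigma> x') (code_items r \<sigma> gs'))"
      proof -
        have "mset (ys @ [e]) = add_mset x' (mset gs')"
          using x(2) by (simp add: x'_def gs'_def)
        moreover have "\<forall>f\<in>set (ys @ [e]). \<sigma> f / r f \<le> \<sigma> x' / r x'"
          using x(3) by (auto simp: x'_def intro: order.trans less_imp_le)
        ultimately show ?thesis by auto
      qed
      ultimately show ?thesis by blast
    qed
  qed (use assms in auto)
  then show ?thesis
    using assms by auto
qed

definition iter_step :: "prog \<Rightarrow> prog" where
  "iter_step p =
     Seq (Call 1 (fold_prog weigh_step) (fold_input Null Null (Right acc_expr)))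
    (Seq (Call 2 p (Pairing (Right env_expr) (Var 1)))
    (Seq (Call 3 (fold_prog total_step)
       (fold_input (Pairing (Lit 0) (Lit 0)) (Right acc_expr) (Var 2)))
    (Seq (Call 4 (fold_prog extract_step)
       (fold_input (Pairing Null Null) Null (Right acc_expr)))
    (Cond (Compare Less (Left env_expr) (Right (Var 3)))
       (Assign 0 (Pairing (Left acc_expr) (Right (Var 4))))
       (Cond (Compare Less (Right (Left acc_expr)) (Left (Var 3)))
         (Assign 0 (Pairing (Pairing (Var 2) (Left (Var 3))) (Right (Var 4))))
         (Assign 0 (Pairing (Left acc_expr) (Right (Var 4)))))))))"

definition greedy_prog :: "prog \<Rightarrow> prog" where
  "greedy_prog p =
     Seq (Call 1 (fold_prog filter_step) (fold_input Null (Left (Var 0)) (Right (Right (Var 0)))))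
    (Seq (Call 2 (fold_prog single_step) (fold_input (Pairing Null (Lit 0)) Null (Var 1)))
    (Seq (Call 3 (fold_prog (iter_step p))
       (fold_input (Pairing (Var 2) (Var 1)) (Pairing (Left (Var 0)) (Left (Right (Var 0)))) (Var 1)))
    (Assign 0 (Left (Left (Var 3))))))"

definition approximates ::
  "prog \<Rightarrow> real \<Rightarrow> (nat set \<Rightarrow> real) \<Rightarrow> val \<Rightarrow> nat set set \<Rightarrow> nat \<Rightarrow> bool" where
  "approximates p c r nv G T \<longleftrightarrow> (\<forall>hs. distinct hs \<and> set hs \<subseteq> G \<longrightarrow>
     (\<exists>es. runs_within p (Cell nv (code_list (map (\<lambda>e. Cell (code_edge e) (Num (r e))) hs))) T
         (code_matching es) \<and> distinct es \<and> set es \<subseteq> set hs \<and> disjoint (set es) \<and>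
       (\<forall>M\<subseteq>set hs. disjoint M \<longrightarrow> c * sum r M \<le> sum r (set es))))"

definition iter_time :: "nat \<Rightarrow> nat \<Rightarrow> nat" where
  "iter_time T n = T + (n + 1) * 40 + (n + 1) * ((n + 1) * ((n + 1) * 40 + 80) + 40) +
     (n + 1) * 120 + 200"

definition greedy_time :: "nat \<Rightarrow> nat \<Rightarrow> nat" where
  "greedy_time T n = (n + 1) * 60 + (n + 1) * 60 + (n + 1) * (iter_time T n + 20) + 100"

lemma runs_iter_step:
  assumes p: "approximates p c r nv G T"
    and hs: "distinct hs" "set hs \<subseteq> G" "hs \<noteq> []" "length hs \<le> n"
    and fin: "\<And>e. e \<in> set hs \<Longrightarrow> finite e \<and> card e \<le> n"
  shows "\<exists>es x gs. distinct es \<and> set es \<subseteq> set hs \<and> disjoint (set es) \<and>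
    (\<forall>M\<subseteq>set hs. disjoint M \<longrightarrow> c * sum r M \<le> sum r (set es)) \<and>
    mset hs = add_mset x (mset gs) \<and> (\<forall>e\<in>set hs. \<sigma> e / r e \<le> \<sigma> x / r x) \<and>
    runs_within (iter_step p)
      (Cell (Cell (Cell (Cell (code_matching bs) (Num b)) (code_items r \<sigma> hs)) (Cell (Num B) nv)) y)
      (iter_time T n)
      (Cell (if sum \<sigma> (set es) \<le> B \<and> b < sum r (set es)
          then Cell (code_matching es) (Num (sum r (set es)))
          else Cell (code_matching bs) (Num b))
        (code_items r \<sigma> gs))"
proof -
  obtain t1 where t1: "t1 \<le> (n + 1) * 40" "runs (fold_prog weigh_step)
      (Cell (Cell Nul Nul) (code_items r \<sigma> hs)) t1
      (code_list (map (\<lambda>e. Cell (code_edge e) (Num (r e))) (rev hs)))"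
    using runs_weigh[OF hs(4)] unfolding runs_within_def by blast
  obtain es t2 where t2: "t2 \<le> T"
      "runs p (Cell nv (code_list (map (\<lambda>e. Cell (code_edge e) (Num (r e))) (rev hs)))) t2
         (code_matching es)"
    and es: "distinct es" "set es \<subseteq> set hs" "disjoint (set es)"
      "\<forall>M\<subseteq>set hs. disjoint M \<longrightarrow> c * sum r M \<le> sum r (set es)"
    using p[unfolded approximates_def, rule_format, of "rev hs"] hs(1,2)
    unfolding runs_within_def set_rev distinct_rev by blast
  obtain t3 where t3: "t3 \<le> (n + 1) * ((n + 1) * ((n + 1) * 40 + 80) + 40)"
      "runs (fold_prog total_step)
        (Cell (Cell (Cell (Num 0) (Num 0)) (code_items r \<sigma> hs)) (code_matching es)) t3
        (Cell (Num (sum r (set es))) (Num (sum \<sigma> (set es))))"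
    using runs_total[OF fin hs(1,4) es(1,2)] unfolding runs_within_def by blast
  obtain x gs t4 where t4: "t4 \<le> (n + 1) * 120"
      "runs (fold_prog extract_step) (Cell (Cell (Cell Nul Nul) Nul) (code_items r \<sigma> hs)) t4
        (Cell (code_item r \<sigma> x) (code_items r \<sigma> gs))"
    and x: "mset hs = add_mset x (mset gs)" "\<forall>e\<in>set hs. \<sigma> e / r e \<le> \<sigma> x / r x"
    using runs_extract[OF hs(4,3)] unfolding runs_within_def by blast
  let ?v = "Cell (Cell (Cell (Cell (code_matching bs) (Num b)) (code_items r \<sigma> hs)) (Cell (Num B) nv)) y"
  let ?w = "Cell (if sum \<sigma> (set es) \<le> B \<and> b < sum r (set es)
      then Cell (code_matching es) (Num (sum r (set es)))
      else Cell (code_matching bs) (Num b)) (code_items r \<sigma> gs)"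
  have time: "t1 + t2 + t3 + t4 + 200 \<le> iter_time T n"
    using t1(1) t2(1) t3(1) t4(1) unfolding iter_time_def by linarith
  have "wp (iter_step p) (\<lambda>t s. t \<le> t1 + t2 + t3 + t4 + 200 \<and> s 0 = ?w) (init_store ?v)"
    using t1(2) t2(2) t3(2) t4(2) by (simp add: iter_step_def init_store_def wp_Call)
  then have "runs_within (iter_step p) ?v (t1 + t2 + t3 + t4 + 200) ?w"
    by (rule runs_withinI)
  then have "runs_within (iter_step p) ?v (iter_time T n) ?w"
    using time by (rule runs_within_mono)
  then show ?thesis
    using es x by blast
qed

lemma runs_greedy:
  assumes c: "0 \<le> c" and B: "0 \<le> B"
    and es: "distinct es" "length es \<le> n" "\<And>e. e \<in> set es \<Longrightarrow> finite e \<and> card e \<le> n"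
    and \<sigma>: "\<And>e. e \<in> set es \<Longrightarrow> 0 \<le> \<sigma> e"
    and G: "G = {e \<in> set es. 0 < r e \<and> \<sigma> e \<le> B}"
    and p: "approximates p c r nv G T"
  shows "\<exists>bs. runs_within (greedy_prog p) (Cell (Num B) (Cell nv (code_items r \<sigma> es)))
      (greedy_time T n) (code_matching bs) \<and> distinct bs \<and> set bs \<subseteq> set es \<and> disjoint (set bs) \<and>
    sum \<sigma> (set bs) \<le> B \<and> near_optimal c r \<sigma> B G (sum r (set bs))"
proof -
  define gl where "gl = rev (filter (\<lambda>e. 0 < r e \<and> \<sigma> e \<le> B) es)"
  have gl: "set gl = G" "distinct gl" "length gl \<le> n"
    using es(1,2) by (auto simp: gl_def G intro: order.trans[OF length_filter_le])
  have G': "finite G" "\<And>e. e \<in> G \<Longrightarrow> 0 < r e" "\<And>e. e \<in> G \<Longrightarrow> 0 \<le> \<sigma> e" "\<And>e. e \<in> G \<Longrightarrow> \<sigma> e \<le> B"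
    "\<And>e. e \<in> G \<Longrightarrow> finite e \<and> card e \<le> n"
    using es(3) \<sigma> by (auto simp: G)
  obtain t1 where t1: "t1 \<le> (n + 1) * 60" "runs (fold_prog filter_step)
      (Cell (Cell Nul (Num B)) (code_items r \<sigma> es)) t1 (code_items r \<sigma> gl)"
    using runs_filter[OF es(2)] unfolding runs_within_def gl_def by blast
  obtain b0 t2 where t2: "t2 \<le> (n + 1) * 60" "runs (fold_prog single_step)
      (Cell (Cell (Cell Nul (Num 0)) Nul) (code_items r \<sigma> gl)) t2
      (Cell (code_matching b0) (Num (sum r (set b0))))"
    and b0: "b0 = [] \<or> (\<exists>e\<in>G. b0 = [e])" "0 \<le> sum r (set b0)" "\<forall>e\<in>G. r e \<le> sum r (set b0)"
    using runs_single[OF gl(3)] unfolding runs_within_def gl(1) by blast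
  define sound where "sound = (\<lambda>bs. distinct bs \<and> set bs \<subseteq> G \<and> disjoint (set bs) \<and>
    sum \<sigma> (set bs) \<le> B \<and> 0 \<le> sum r (set bs) \<and> (\<forall>e\<in>G. r e \<le> sum r (set bs)))"
  define I where "I = (\<lambda>(ys :: nat set list) a. \<exists>bs hs.
    a = Cell (Cell (code_matching bs) (Num (sum r (set bs)))) (code_items r \<sigma> hs) \<and> sound bs \<and>
    distinct hs \<and> set hs \<subseteq> G \<and> length hs + length ys = length gl \<and>
    (near_optimal c r \<sigma> B G (sum r (set bs)) \<or> set hs = G \<or> budget_exceeded r \<sigma> B G (set hs)))"
  let ?env = "Cell (Num B) nv"
  have "\<exists>w. runs_within (fold_prog (iter_step p))
      (Cell (Cell (Cell (Cell (code_matching b0) (Num (sum r (set b0)))) (code_items r \<sigma> gl)) ?env)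
        (code_items r \<sigma> gl))
      ((n + 1) * (iter_time T n + 20)) w \<and> I gl w"
  proof (rule runs_fold_prog)
    have "sound b0"
      using b0 B G' by (auto simp: sound_def)
    then show "I [] (Cell (Cell (code_matching b0) (Num (sum r (set b0)))) (code_items r \<sigma> gl))"
      unfolding I_def using gl by auto
    fix ys y zs a
    assume split: "gl = ys @ y # zs" and "I ys a"
    then obtain bs hs where
      a: "a = Cell (Cell (code_matching bs) (Num (sum r (set bs)))) (code_items r \<sigma> hs)"
      and bs: "sound bs"
      and hs: "distinct hs" "set hs \<subseteq> G" "length hs + length ys = length gl"
      and progress: "near_optimal c r \<sigma> B G (sum r (set bs)) \<or> set hs = G \<or>
        budget_exceeded r \<sigma> B G (set hs)"
      unfolding I_def by blast
    have hs': "hs \<noteq> []" "length hs \<le> n"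
      using hs(3) split gl(3) by auto
    have fin: "finite e \<and> card e \<le> n" if "e \<in> set hs" for e
      using that hs(2) G'(5) by blast
    obtain ms x gs where ms: "distinct ms" "set ms \<subseteq> set hs" "disjoint (set ms)"
        "\<forall>M\<subseteq>set hs. disjoint M \<longrightarrow> c * sum r M \<le> sum r (set ms)"
      and x: "mset hs = add_mset x (mset gs)" "\<forall>e\<in>set hs. \<sigma> e / r e \<le> \<sigma> x / r x"
      and run: "runs_within (iter_step p) (Cell (Cell a ?env) (code_item r \<sigma> y)) (iter_time T n)
        (Cell (if sum \<sigma> (set ms) \<le> B \<and> sum r (set bs) < sum r (set ms)
            then Cell (code_matching ms) (Num (sum r (set ms)))
            else Cell (code_matching bs) (Num (sum r (set bs))))
          (code_items r \<sigma> gs))"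
      using runs_iter_step[OF p hs(1,2) hs' fin] unfolding a by metis
    define bs' where
      "bs' = (if sum \<sigma> (set ms) \<le> B \<and> sum r (set bs) < sum r (set ms) then ms else bs)"
    have sound': "sound bs'"
      using bs ms hs(2) by (auto simp: bs'_def sound_def intro: order.trans less_imp_le)
    have mono: "sum r (set bs) \<le> sum r (set bs')"
      "sum \<sigma> (set ms) \<le> B \<Longrightarrow> sum r (set ms) \<le> sum r (set bs')"
      by (auto simp: bs'_def)
    have gs: "set hs = insert x (set gs)" "length hs = Suc (length gs)" "distinct gs"
      using x(1) hs(1)
      by (metis set_mset_add_mset_insert set_mset_mset, metis size_add_mset size_mset,
          metis distinct.simps(2) mset.simps(2) mset_eq_imp_distinct_iff)
    have "near_optimal c r \<sigma> B G (sum r (set bs')) \<or> budget_exceeded r \<sigma> B G (set gs)"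
    proof (cases "near_optimal c r \<sigma> B G (sum r (set bs))")
      case True
      have "(2 + c) * sum r (set bs) \<le> (2 + c) * sum r (set bs')"
        using mono(1) c by (intro mult_left_mono) auto
      then show ?thesis
        using True unfolding near_optimal_def by (meson order.trans)
    next
      case False
      show ?thesis
        by (rule near_optimal_step[OF c G'(1-3), where x = x and M = "set ms"])
          (use False progress gs(1) hs(2) x(2) ms mono(2) sound' in \<open>auto simp: sound_def\<close>)
    qed
    then have "I (ys @ [y])
        (Cell (Cell (code_matching bs') (Num (sum r (set bs')))) (code_items r \<sigma> gs))"
      unfolding I_def using sound' gs hs(2,3) by (intro exI[of _ bs'] exI[of _ gs]) auto
    moreover have "runs_within (iter_step p) (Cell (Cell a ?env) (code_item r \<sigma> y)) (iter_time T n)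
        (Cell (Cell (code_matching bs') (Num (sum r (set bs')))) (code_items r \<sigma> gs))"
      using run by (cases "sum \<sigma> (set ms) \<le> B \<and> sum r (set bs) < sum r (set ms)")
        (simp_all only: bs'_def if_True if_False simp_thms)
    ultimately show "\<exists>a'. runs_within (iter_step p) (Cell (Cell a ?env) (code_item r \<sigma> y))
        (iter_time T n) a' \<and> I (ys @ [y]) a'"
      by blast
  qed (rule gl(3))
  then obtain bs hs t3 where t3: "t3 \<le> (n + 1) * (iter_time T n + 20)"
      "runs (fold_prog (iter_step p))
        (Cell (Cell (Cell (Cell (code_matching b0) (Num (sum r (set b0)))) (code_items r \<sigma> gl)) ?env)
          (code_items r \<sigma> gl)) t3
        (Cell (Cell (code_matching bs) (Num (sum r (set bs)))) (code_items r \<sigma> hs))"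
    and bs: "sound bs" and "length hs + length gl = length gl"
    and "near_optimal c r \<sigma> B G (sum r (set bs)) \<or> set hs = G \<or> budget_exceeded r \<sigma> B G (set hs)"
    unfolding runs_within_def I_def by blast
  then have progress: "near_optimal c r \<sigma> B G (sum r (set bs)) \<or> G = {} \<or>
      budget_exceeded r \<sigma> B G {}"
    by auto
  have "\<not> budget_exceeded r \<sigma> B G {}"
  proof
    assume "budget_exceeded r \<sigma> B G {}"
    then obtain x M where "x \<in> G" "M \<subseteq> {x}" "B < sum \<sigma> M"
      unfolding budget_exceeded_def by blast
    then show False
      using B G'(4)[of x] by (auto simp: subset_singleton_iff)
  qed
  moreover have "near_optimal c r \<sigma> B G (sum r (set bs))" if "G = {}"
    using that bs c by (auto simp: near_optimal_def sound_def)
  ultimately have near: "near_optimal c r \<sigma> B G (sum r (set bs))"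
    using progress by blast
  let ?v = "Cell (Num B) (Cell nv (code_items r \<sigma> es))"
  have time: "t1 + t2 + t3 + 100 \<le> greedy_time T n"
    using t1(1) t2(1) t3(1) unfolding greedy_time_def by linarith
  have "wp (greedy_prog p) (\<lambda>t s. t \<le> t1 + t2 + t3 + 100 \<and> s 0 = code_matching bs) (init_store ?v)"
    using t1(2) t2(2) t3(2) by (simp add: greedy_prog_def init_store_def wp_Call)
  then have "runs_within (greedy_prog p) ?v (t1 + t2 + t3 + 100) (code_matching bs)"
    by (rule runs_withinI)
  then have "runs_within (greedy_prog p) ?v (greedy_time T n) (code_matching bs)"
    using time by (rule runs_within_mono)
  then show ?thesis
    using bs near unfolding sound_def G by blast
qed

section \<open>Input sizes\<close>

lemma poly_nat_mono: "m \<le> n \<Longrightarrow> poly q m \<le> poly (q :: nat poly) n"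
  by (induction q) (auto intro: add_mono mult_mono)

lemma val_size_code_list: "val_size (code_list vs) = 1 + (\<Sum>v\<leftarrow>vs. 1 + val_size v)"
  by (induction vs) auto

lemma length_le_val_size: "length vs \<le> val_size (code_list vs)"
  by (induction vs) auto

lemma val_size_le_code_list: "v \<in> set vs \<Longrightarrow> val_size v \<le> val_size (code_list vs)"
  by (induction vs) auto

lemma card_le_val_size_code_edge: "finite e \<Longrightarrow> card e \<le> val_size (code_edge e)"
  using length_le_val_size[of "map (\<lambda>v. Num (real v)) (sorted_list_of_set e)"]
  by (simp add: code_edge_def code_nodes_def)

lemma code_budgeted_items:
  "code_budgeted (U, B) = Cell (Num B) (Cell (code_nodes [0..<nodes U])
     (code_items (expected_reward U) (reward_sd U) (edges U)))"
  by (simp add: code_budgeted_def code_item_def[abs_def])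

lemma val_size_code_weighted_le:
  assumes "distinct (edges U)" "distinct hs" "set hs \<subseteq> edge_set U"
  shows "val_size (code_weighted \<lparr>nodes = nodes U, edges = hs, weight = w\<rparr>)
    \<le> val_size (code_budgeted (U, B))"
proof -
  have "(\<Sum>e\<leftarrow>hs. 3 + val_size (code_edge e)) = (\<Sum>e\<in>set hs. 3 + val_size (code_edge e))"
    using assms by (simp add: sum_list_distinct_conv_sum_set)
  also have "\<dots> \<le> (\<Sum>e\<in>edge_set U. 5 + val_size (code_edge e))"
    by (rule order.trans[OF sum_mono2 sum_mono]) (use assms in auto)
  also have "\<dots> = (\<Sum>e\<leftarrow>edges U. 5 + val_size (code_edge e))"
    using assms by (simp add: sum_list_distinct_conv_sum_set)
  finally show ?thesis
    by (simp add: code_weighted_def code_budgeted_def val_size_code_list comp_def eval_nat_numeral)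
qed

lemma edge_bounds:
  assumes "hypergraph U"
  shows "length (edges U) \<le> val_size (code_budgeted (U, B))"
    and "e \<in> edge_set U \<Longrightarrow> finite e \<and> card e \<le> val_size (code_budgeted (U, B))"
proof -
  let ?is = "code_items (expected_reward U) (reward_sd U) (edges U)"
  have items: "val_size ?is \<le> val_size (code_budgeted (U, B))"
    by (simp add: code_budgeted_items)
  then show "length (edges U) \<le> val_size (code_budgeted (U, B))"
    using length_le_val_size[of "map (code_item (expected_reward U) (reward_sd U)) (edges U)"] by simp
  assume e: "e \<in> edge_set U"
  then have fin: "finite e"
    using assms unfolding hypergraph_def by (meson finite_lessThan finite_subset)
  have "card e \<le> val_size (code_edge e)"
    using fin by (rule card_le_val_size_code_edge)
  also have "\<dots> \<le> val_size (code_item (expected_reward U) (reward_sd U) e)"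
    by (simp add: code_item_def)
  also have "\<dots> \<le> val_size ?is"
    using e by (intro val_size_le_code_list) auto
  finally show "finite e \<and> card e \<le> val_size (code_budgeted (U, B))"
    using fin items by simp
qed

lemma reward_sd_nonneg: "0 \<le> reward_sd U e"
  by (simp add: reward_sd_def)

lemma approximatesI:
  assumes c: "0 \<le> c"
    and q: "\<forall>H\<in>{H. weighted_hypergraph H}. \<exists>t out M. runs p (code_weighted H) t out \<and>
      t \<le> poly q (val_size (code_weighted H)) \<and> codes_edge_set out M \<and> approx_matching c H M"
    and U: "hypergraph U" "G \<subseteq> edge_set U" "\<And>e. e \<in> G \<Longrightarrow> 0 \<le> r e"
  shows "approximates p c r (code_nodes [0..<nodes U]) G (poly q (val_size (code_budgeted (U, B))))"
  unfolding approximates_def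
proof (intro allI impI, elim conjE)
  fix hs assume hs: "distinct hs" "set hs \<subseteq> G"
  define H where "H = \<lparr>nodes = nodes U, edges = hs, weight = r\<rparr>"
  have "\<forall>e\<in>set hs. e \<noteq> {} \<and> e \<subseteq> {..<nodes U}" "\<forall>e\<in>set hs. 0 \<le> r e"
    using U hs unfolding hypergraph_def by blast+
  then have "weighted_hypergraph H"
    using hs by (simp add: weighted_hypergraph_def hypergraph_def H_def)
  then obtain t out M where run: "runs p (code_weighted H) t out"
    and t: "t \<le> poly q (val_size (code_weighted H))" and "codes_edge_set out M"
    and M: "approx_matching c H M"
    using q by blast
  then obtain es where es: "distinct es" "set es = M" "out = code_matching es"
    unfolding codes_edge_set_def by blast
  have "val_size (code_weighted H) \<le> val_size (code_budgeted (U, B))"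
    unfolding H_def by (rule val_size_code_weighted_le) (use U hs in \<open>auto simp: hypergraph_def\<close>)
  then have "runs_within p (code_weighted H) (poly q (val_size (code_budgeted (U, B)))) out"
    using run t poly_nat_mono order.trans unfolding runs_within_def by blast
  moreover have "c * sum r M' \<le> sum r M" if M': "M' \<subseteq> set hs" "disjoint M'" for M'
  proof -
    have "finite {M'. hypermatching H M'}"
      by (rule finite_subset[of _ "Pow (edge_set H)"]) (auto simp: hypermatching_def)
    then have "total_weight H M' \<le> Max (total_weight H ` {M'. hypermatching H M'})"
      using M' by (intro Max_ge) (auto simp: hypermatching_def H_def)
    then have "c * total_weight H M' \<le> c * Max (total_weight H ` {M'. hypermatching H M'})"
      using c by (rule mult_left_mono)
    also have "\<dots> \<le> total_weight H M"
      using M unfolding approx_matching_def by blast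
    finally show ?thesis
      by (simp add: total_weight_def H_def)
  qed
  moreover have "M \<subseteq> set hs" "disjoint M"
    using M by (auto simp: approx_matching_def hypermatching_def H_def)
  ultimately show "\<exists>es. runs_within p (Cell (code_nodes [0..<nodes U])
      (code_list (map (\<lambda>e. Cell (code_edge e) (Num (r e))) hs)))
      (poly q (val_size (code_budgeted (U, B)))) (code_matching es) \<and> distinct es \<and>
      set es \<subseteq> set hs \<and> disjoint (set es) \<and>
      (\<forall>M\<subseteq>set hs. disjoint M \<longrightarrow> c * sum r M \<le> sum r (set es))"
    using es by (intro exI[of _ es]) (auto simp: code_weighted_def H_def)
qed

lemma approx_budgeted_matchingI:
  assumes c: "0 \<le> c" and B: "0 \<le> B"
    and G: "G = {e \<in> edge_set U. 0 < expected_reward U e \<and> reward_sd U e \<le> B}"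
    and M: "M \<subseteq> edge_set U" "disjoint M" "sum (reward_sd U) M \<le> B"
    and near: "near_optimal c (expected_reward U) (reward_sd U) B G (sum (expected_reward U) M)"
  shows "approx_budgeted_matching (c / (2 + c)) (U, B) M"
proof -
  let ?r = "expected_reward U" and ?\<sigma> = "reward_sd U"
  let ?F = "{M'. hypermatching U M' \<and> risk U M' \<le> B}"
  have "finite ?F"
    by (rule finite_subset[of _ "Pow (edge_set U)"]) (auto simp: hypermatching_def)
  moreover have "{} \<in> ?F"
    using B by (simp add: hypermatching_def risk_def)
  ultimately have "Max (expected_weight U ` ?F) \<in> expected_weight U ` ?F"
    by (intro Max_in) auto
  then obtain N where N: "N \<subseteq> edge_set U" "disjoint N" "sum ?\<sigma> N \<le> B"
    and max: "Max (expected_weight U ` ?F) = sum ?r N"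
    by (auto simp: hypermatching_def risk_def expected_weight_def)
  have fin: "finite N"
    using N(1) by (rule finite_subset) simp
  have "sum ?r (N - G) \<le> 0"
  proof (rule sum_nonpos)
    fix e assume e: "e \<in> N - G"
    then have "?\<sigma> e \<le> sum ?\<sigma> N"
      using fin by (intro member_le_sum) (auto simp: reward_sd_nonneg)
    then show "?r e \<le> 0"
      using e N by (force simp: G)
  qed
  then have "sum ?r N \<le> sum ?r (N \<inter> G)"
    using sum.Int_Diff[OF fin, of ?r G] by simp
  then have "c * sum ?r N \<le> c * sum ?r (N \<inter> G)"
    using c by (rule mult_left_mono)
  also have "\<dots> \<le> (2 + c) * sum ?r M"
  proof -
    have "sum ?\<sigma> (N \<inter> G) \<le> sum ?\<sigma> N"
      using fin by (intro sum_mono2) (auto simp: reward_sd_nonneg)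
    moreover have "disjoint (N \<inter> G)"
      using N(2) by (rule pairwise_subset) simp
    ultimately show ?thesis
      using near N(3) unfolding near_optimal_def by simp
  qed
  finally have "c / (2 + c) * sum ?r N \<le> sum ?r M"
    using c by (simp add: field_simps)
  then show ?thesis
    using M max
    by (simp add: approx_budgeted_matching_def hypermatching_def risk_def expected_weight_def)
qed

theorem theorem3:
  fixes c :: real and match_alg :: prog
  assumes "0 \<le> c" and "c \<le> 1"
    and "solves_in_poly_time match_alg {H. weighted_hypergraph H} code_weighted
           (approx_matching c)"
  shows "\<exists>p. solves_in_poly_time p {(U, B). uncertain_hypergraph U \<and> 0 \<le> B} code_budgeted
           (approx_budgeted_matching (c / (2 + c)))"
proof -
  obtain q :: "nat poly" where q: "\<forall>H\<in>{H. weighted_hypergraph H}. \<exists>t out M.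
      runs match_alg (code_weighted H) t out \<and> t \<le> poly q (val_size (code_weighted H)) \<and>
      codes_edge_set out M \<and> approx_matching c H M"
    using assms(3) unfolding solves_in_poly_time_def by blast
  let ?L = "[:1, 1:] :: nat poly"
  define iq where "iq = q + ?L * [:40:] + ?L * (?L * (?L * [:40:] + [:80:]) + [:40:]) +
    ?L * [:120:] + [:200:]"
  define gq where "gq = ?L * [:60:] + ?L * [:60:] + ?L * (iq + [:20:]) + [:100:]"
  have gq: "poly gq n = greedy_time (poly q n) n" for n
    by (simp add: gq_def iq_def greedy_time_def iter_time_def algebra_simps)
  have "\<exists>t out M. runs (greedy_prog match_alg) (code_budgeted (U, B)) t out \<and>
      t \<le> poly gq (val_size (code_budgeted (U, B))) \<and> codes_edge_set out M \<and>
      approx_budgeted_matching (c / (2 + c)) (U, B) M"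
    if "uncertain_hypergraph U" and B: "0 \<le> B" for U B
  proof -
    have U: "hypergraph U"
      using that unfolding uncertain_hypergraph_def by blast
    let ?n = "val_size (code_budgeted (U, B))"
    define G where "G = {e \<in> edge_set U. 0 < expected_reward U e \<and> reward_sd U e \<le> B}"
    have match: "approximates match_alg c (expected_reward U) (code_nodes [0..<nodes U]) G (poly q ?n)"
      by (rule approximatesI[OF assms(1) q U]) (auto simp: G_def)
    have "distinct (edges U)"
      using U unfolding hypergraph_def by blast
    from runs_greedy[OF assms(1) B this edge_bounds[OF U] reward_sd_nonneg G_def match]
    obtain bs where run: "runs_within (greedy_prog match_alg) (code_budgeted (U, B))
        (greedy_time (poly q ?n) ?n) (code_matching bs)"
      and bs: "distinct bs" "set bs \<subseteq> edge_set U" "disjoint (set bs)"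
        "sum (reward_sd U) (set bs) \<le> B"
        "near_optimal c (expected_reward U) (reward_sd U) B G (sum (expected_reward U) (set bs))"
      unfolding code_budgeted_items by blast
    have "approx_budgeted_matching (c / (2 + c)) (U, B) (set bs)"
      by (rule approx_budgeted_matchingI[OF assms(1) B G_def bs(2-5)])
    moreover have "codes_edge_set (code_matching bs) (set bs)"
      using bs(1) unfolding codes_edge_set_def by blast
    ultimately show ?thesis
      using run unfolding gq runs_within_def by blast
  qed
  then show ?thesis
    unfolding solves_in_poly_time_def by (intro exI[of _ "greedy_prog match_alg"] exI[of _ gq]) auto
qed

end
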